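(* Let $n\geq 2$ and define the linear map on operators on $(\mathbb{C}^2)^{\otimes n}$ $$\Phi_{Tx,n}[\rho]=\sum_{A}\big((\tilde\sigma_x^A\circ T_A)\otimes I_{\bar A}\big)[\rho]+\frac{2^{n-1}-2}{2}\,\mathrm{Tr}(\rho)\,\mathbb{1},$$ where the sum runs over the $2^{n-1}-1$ bipartitions $A|\bar A$ of $\{1,\dots,n\}$. Then $\Phi_{Tx,n}[\rho]\geq 0$ for every $n$-partite biseparable state $\rho$ on $(\mathbb{C}^2)^{\otimes n}$.
   Context: The sum over $A$ is over all partitions of $\{1,\dots,n\}$ into two non-empty parts $\{A,\bar A\}$, each bipartition being counted once, with one (arbitrarily chosen and fixed) of its two parts called $A$. $T_A$ is the transposition on operators on $(\mathbb{C}^2)^{\otimes A}$ in the computational basis, $I_{\bar A}$ is the identity map on operators on the complementary subsystems, $\mathbb{1}$ is the identity operator, and $\tilde\sigma_x^A[X]=\sigma_x^{\otimes A}X\,\sigma_x^{\otimes A}$, with $\sigma_x=\begin{pmatrix}0&1\\1&0\end{pmatrix}$ acting on each qubit in $A$. "$\geq 0$" means positive semidefinite. A state is a positive semidefinite operator of trace one. An $n$-partite state is biseparable if it is a finite convex combination of states, each of which is a product state $\rho_A\otimes\rho_{\bar A}$ with respect to some bipartition $A|\bar A$ of $\{1,\dots,n\}$ into two non-empty parts (different terms may use different bipartitions). *)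

theory Defs
  imports
    "HOL-Library.Disjoint_Sets"
    "Jordan_Normal_Form.Matrix"
begin

text \<open>
  Qubits are numbered \<open>0, \<dots>, n - 1\<close>. Operators on \<open>m\<close> qubits are complex matrices of dimension
  \<open>2^m\<close>; the computational basis vector with number \<open>i < 2^m\<close> is the one whose \<open>k\<close>-th qubit is in
  the state \<open>bit i k\<close>. For a set \<open>A\<close> of qubits, an operator on the qubits in \<open>A\<close> is an operator
  on \<open>card A\<close> qubits, the elements of \<open>A\<close> being taken in increasing order.
\<close>

subsection \<open>Positive semidefinite operators and states\<close>

text \<open>
  The order on \<^typ>\<open>complex\<close> is the one where \<open>0 \<le> z\<close> means that \<open>z\<close> is real and nonnegative, so
  a positive semidefinite matrix is in particular Hermitian.
\<close>

definition psd :: "nat \<Rightarrow> complex mat \<Rightarrow> bool" where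
  "psd d M \<longleftrightarrow> M \<in> carrier_mat d d \<and> (\<forall>v \<in> carrier_vec d. 0 \<le> (M *\<^sub>v v) \<bullet>c v)"

definition tr :: "complex mat \<Rightarrow> complex" where
  "tr M = (\<Sum>i<dim_row M. M $$ (i, i))"

definition state :: "nat \<Rightarrow> complex mat \<Rightarrow> bool" where
  "state m \<rho> \<longleftrightarrow> psd (2 ^ m) \<rho> \<and> tr \<rho> = 1"


subsection \<open>Subsystems\<close>

text \<open>
  \<open>bits_on A i\<close> is the number of the basis vector of the subsystem \<open>A\<close> obtained by restricting the
  bit string \<open>i\<close> to \<open>A\<close>. Conversely, \<open>merge_bits n A a b\<close> is the basis vector of the full system
  whose restrictions to \<open>A\<close> and to the complement of \<open>A\<close> are \<open>a\<close> and \<open>b\<close>.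
\<close>

definition bits_on :: "nat set \<Rightarrow> nat \<Rightarrow> nat" where
  "bits_on A i = horner_sum of_bool 2 (map (bit i) (sorted_list_of_set A))"

definition merge_bits :: "nat \<Rightarrow> nat set \<Rightarrow> nat \<Rightarrow> nat \<Rightarrow> nat" where
  "merge_bits n A a b = horner_sum of_bool 2
     (map (\<lambda>k. if k \<in> A then bit a (card {l \<in> A. l < k})
               else bit b (card {l \<in> {..<n} - A. l < k})) [0..<n])"

definition tensor_op :: "nat \<Rightarrow> nat set \<Rightarrow> complex mat \<Rightarrow> complex mat \<Rightarrow> complex mat" where
  "tensor_op n A X Y = mat (2 ^ n) (2 ^ n) (\<lambda>(i, j).
     X $$ (bits_on A i, bits_on A j) * Y $$ (bits_on ({..<n} - A) i, bits_on ({..<n} - A) j))"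

text \<open>
  The extension \<open>\<Lambda> \<otimes> I\<close> of a linear map \<open>\<Lambda>\<close> on the operators on \<open>A\<close>: it is applied to each of the
  blocks obtained by fixing the row and column indices outside \<open>A\<close>.
\<close>

definition tensor_id_map ::
  "nat \<Rightarrow> nat set \<Rightarrow> (complex mat \<Rightarrow> complex mat) \<Rightarrow> complex mat \<Rightarrow> complex mat" where
  "tensor_id_map n A \<Lambda> X = mat (2 ^ n) (2 ^ n) (\<lambda>(i, j).
     \<Lambda> (mat (2 ^ card A) (2 ^ card A) (\<lambda>(a, b).
          X $$ (merge_bits n A a (bits_on ({..<n} - A) i),
                merge_bits n A b (bits_on ({..<n} - A) j))))
     $$ (bits_on A i, bits_on A j))"


subsection \<open>Bipartitions and biseparable states\<close>

definition bipartitions :: "nat \<Rightarrow> nat set set set" where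
  "bipartitions n = {P. partition_on {..<n} P \<and> card P = 2}"

definition product_state :: "nat \<Rightarrow> nat set \<Rightarrow> complex mat \<Rightarrow> bool" where
  "product_state n A \<rho> \<longleftrightarrow>
     (\<exists>\<rho>\<^sub>A \<rho>\<^sub>B. state (card A) \<rho>\<^sub>A \<and> state (card ({..<n} - A)) \<rho>\<^sub>B \<and> \<rho> = tensor_op n A \<rho>\<^sub>A \<rho>\<^sub>B)"

definition biseparable :: "nat \<Rightarrow> complex mat \<Rightarrow> bool" where
  "biseparable n \<rho> \<longleftrightarrow> state n \<rho> \<and>
     (\<exists>(m::nat) (p :: nat \<Rightarrow> real) \<sigma>.
        (\<forall>k<m. 0 \<le> p k) \<and> (\<Sum>k<m. p k) = 1 \<and>
        (\<forall>k<m. \<exists>P \<in> bipartitions n. \<exists>A \<in> P. product_state n A (\<sigma> k)) \<and>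
        \<rho> = mat (2 ^ n) (2 ^ n) (\<lambda>(i, j). \<Sum>k<m. complex_of_real (p k) * \<sigma> k $$ (i, j)))"


subsection \<open>The map\<close>

definition sigma_x :: "complex mat" where
  "sigma_x = mat_of_rows_list 2 [[0, 1], [1, 0]]"

definition sigma_x_pow :: "nat \<Rightarrow> complex mat" where
  "sigma_x_pow m = mat (2 ^ m) (2 ^ m) (\<lambda>(i, j).
     \<Prod>k<m. sigma_x $$ (of_bool (bit i k), of_bool (bit j k)))"

definition sigma_x_conj :: "nat \<Rightarrow> complex mat \<Rightarrow> complex mat" where
  "sigma_x_conj m X = sigma_x_pow m * X * sigma_x_pow m"

text \<open>The function \<open>c\<close> selects the part of each bipartition that is called \<open>A\<close>.\<close>

definition Phi_Tx :: "nat \<Rightarrow> (nat set set \<Rightarrow> nat set) \<Rightarrow> complex mat \<Rightarrow> complex mat" where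
  "Phi_Tx n c X =
     mat (2 ^ n) (2 ^ n) (\<lambda>(i, j). \<Sum>P \<in> bipartitions n.
       tensor_id_map n (c P) (sigma_x_conj (card (c P)) \<circ> transpose_mat) X $$ (i, j))
     + ((2 ^ (n - 1) - 2) / 2 * tr X) \<cdot>\<^sub>m 1\<^sub>m (2 ^ n)"


subsection \<open>Sanity checks\<close>

lemma card_less_nth_sorted_list_of_set:
  fixes A :: "nat set"
  assumes "finite A" "t < card A"
  shows "card {l \<in> A. l < sorted_list_of_set A ! t} = t"
proof -
  let ?xs = "sorted_list_of_set A"
  have len: "length ?xs = card A" and set: "set ?xs = A"
    using assms by auto
  have mono: "?xs ! s < ?xs ! u \<longleftrightarrow> s < u" if "s < card A" "u < card A" for s u
    using that sorted_wrt_nth_less[OF strict_sorted_list_of_set, of s u A]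
      sorted_wrt_nth_less[OF strict_sorted_list_of_set, of u s A] len
    by (cases s u rule: linorder_cases) auto
  have "{l \<in> A. l < ?xs ! t} = (!) ?xs ` {..<t}"
  proof (intro equalityI subsetI)
    fix l assume l: "l \<in> {l \<in> A. l < ?xs ! t}"
    then obtain s where "s < card A" "l = ?xs ! s"
      using set len by (metis (no_types, lifting) in_set_conv_nth mem_Collect_eq)
    with l mono assms show "l \<in> (!) ?xs ` {..<t}" by auto
  next
    fix l assume "l \<in> (!) ?xs ` {..<t}"
    then obtain s where s: "s < t" "l = ?xs ! s" by auto
    then have "l \<in> A" using set len assms by (metis less_trans nth_mem)
    with s mono assms show "l \<in> {l \<in> A. l < ?xs ! t}" by auto
  qed
  moreover have "inj_on ((!) ?xs) {..<t}"
    using assms len by (auto simp: inj_on_def nth_eq_iff_index_eq)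
  ultimately show ?thesis by (simp add: card_image)
qed

lemma card_less_less:
  fixes A :: "nat set"
  assumes "finite A" "k \<in> A"
  shows "card {l \<in> A. l < k} < card A"
  using assms by (intro psubset_card_mono) auto

lemma nth_sorted_list_of_set_card_less:
  fixes A :: "nat set"
  assumes "finite A" "k \<in> A"
  shows "sorted_list_of_set A ! card {l \<in> A. l < k} = k"
proof -
  obtain t where "t < card A" "sorted_list_of_set A ! t = k"
    using assms by (metis in_set_conv_nth length_sorted_list_of_set set_sorted_list_of_set)
  then show ?thesis using card_less_nth_sorted_list_of_set[OF assms(1)] by auto
qed

lemma bit_bits_on:
  "bit (bits_on A i) t \<longleftrightarrow> t < card A \<and> bit i (sorted_list_of_set A ! t)"
  unfolding bits_on_def by (auto simp: bit_horner_sum_bit_iff)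

lemma bit_merge_bits:
  "bit (merge_bits n A a b) k \<longleftrightarrow> k < n \<and>
     (if k \<in> A then bit a (card {l \<in> A. l < k}) else bit b (card {l \<in> {..<n} - A. l < k}))"
  unfolding merge_bits_def by (auto simp: bit_horner_sum_bit_iff)

lemma bits_on_less: "bits_on A i < 2 ^ card A"
  unfolding bits_on_def using horner_sum_of_bool_2_less[of "map (bit i) (sorted_list_of_set A)"]
  by simp

lemma merge_bits_less: "merge_bits n A a b < 2 ^ n"
  unfolding merge_bits_def using horner_sum_of_bool_2_less[of "map _ [0..<n]"] by simp

lemma not_bit_of_less: "\<not> bit a k" if "a < 2 ^ m" "m \<le> k" for a :: nat
  using that by (metis bit_take_bit_iff linorder_not_le take_bit_nat_eq_self_iff)

lemma bits_on_merge_bits: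
  assumes "A \<subseteq> {..<n}" "a < 2 ^ card A"
  shows "bits_on A (merge_bits n A a b) = a"
proof -
  have fin: "finite A" using assms(1) finite_subset by blast
  have "sorted_list_of_set A ! t \<in> A" if "t < card A" for t
    using that fin by (metis length_sorted_list_of_set nth_mem set_sorted_list_of_set)
  then have "bit (bits_on A (merge_bits n A a b)) t = bit a t" for t
    using assms not_bit_of_less[OF assms(2), of t] card_less_nth_sorted_list_of_set[OF fin, of t]
    by (cases "t < card A") (auto simp: bit_bits_on bit_merge_bits)
  then show ?thesis by (rule bit_eqI)
qed

lemma bits_on_compl_merge_bits:
  assumes "b < 2 ^ card ({..<n} - A)"
  shows "bits_on ({..<n} - A) (merge_bits n A a b) = b"
proof -
  let ?B = "{..<n} - A"
  have fin: "finite ?B" by simp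
  have "sorted_list_of_set ?B ! t \<in> ?B" if "t < card ?B" for t
    using that fin by (metis length_sorted_list_of_set nth_mem set_sorted_list_of_set)
  then have "bit (bits_on ?B (merge_bits n A a b)) t = bit b t" for t
    using not_bit_of_less[OF assms, of t] card_less_nth_sorted_list_of_set[OF fin, of t]
    by (cases "t < card ?B") (auto simp: bit_bits_on bit_merge_bits)
  then show ?thesis by (rule bit_eqI)
qed

lemma merge_bits_bits_on:
  assumes "A \<subseteq> {..<n}" "i < 2 ^ n"
  shows "merge_bits n A (bits_on A i) (bits_on ({..<n} - A) i) = i"
proof (rule bit_eqI)
  fix k
  have fin: "finite A" "finite ({..<n} - A)" using assms(1) finite_subset by auto
  have *: "\<not> bit i k" if "\<not> k < n" using not_bit_of_less[OF assms(2)] that by simp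
  consider "\<not> k < n" | "k \<in> A" "k < n" | "k \<in> {..<n} - A" "k < n" "k \<notin> A" by auto
  then show "bit (merge_bits n A (bits_on A i) (bits_on ({..<n} - A) i)) k = bit i k"
  proof cases
    case 1
    then show ?thesis using * by (simp add: bit_merge_bits)
  next
    case 2
    then show ?thesis
      unfolding bit_merge_bits bit_bits_on
      using card_less_less[OF fin(1) 2(1)] nth_sorted_list_of_set_card_less[OF fin(1) 2(1)]
      by presburger
  next
    case 3
    then show ?thesis
      unfolding bit_merge_bits bit_bits_on
      using card_less_less[OF fin(2) 3(1)] nth_sorted_list_of_set_card_less[OF fin(2) 3(1)]
      by presburger
  qed
qed

lemma tensor_id_map_tensor_op:
  assumes A: "A \<subseteq> {..<n}"
    and X: "X \<in> carrier_mat (2 ^ card A) (2 ^ card A)"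
    and carr: "\<Lambda> X \<in> carrier_mat (2 ^ card A) (2 ^ card A)"
    and hom: "\<And>z. \<Lambda> (z \<cdot>\<^sub>m X) = z \<cdot>\<^sub>m \<Lambda> X"
  shows "tensor_id_map n A \<Lambda> (tensor_op n A X Y) = tensor_op n A (\<Lambda> X) Y"
proof (rule eq_matI)
  fix i j
  assume "i < dim_row (tensor_op n A (\<Lambda> X) Y)" "j < dim_col (tensor_op n A (\<Lambda> X) Y)"
  then have ij: "i < 2 ^ n" "j < 2 ^ n" by (simp_all add: tensor_op_def)
  let ?B = "{..<n} - A"
  let ?z = "Y $$ (bits_on ?B i, bits_on ?B j)"
  have "mat (2 ^ card A) (2 ^ card A) (\<lambda>(a, b). tensor_op n A X Y $$
          (merge_bits n A a (bits_on ?B i), merge_bits n A b (bits_on ?B j))) = ?z \<cdot>\<^sub>m X"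
    using X A
    by (intro eq_matI)
      (auto simp: tensor_op_def merge_bits_less bits_on_merge_bits bits_on_compl_merge_bits
        bits_on_less)
  then show "tensor_id_map n A \<Lambda> (tensor_op n A X Y) $$ (i, j) = tensor_op n A (\<Lambda> X) Y $$ (i, j)"
    using ij carr bits_on_less[of A i] bits_on_less[of A j]
    by (simp add: tensor_id_map_def tensor_op_def hom)
qed (simp_all add: tensor_id_map_def tensor_op_def)

lemma bipartitions_iff:
  "P \<in> bipartitions n \<longleftrightarrow> (\<exists>A. A \<noteq> {} \<and> A \<subset> {..<n} \<and> P = {A, {..<n} - A})"
proof
  assume "P \<in> bipartitions n"
  then have P: "partition_on {..<n} P" "card P = 2" by (auto simp: bipartitions_def)
  from P(2) obtain A B where AB: "P = {A, B}" "A \<noteq> B" by (auto simp: card_2_iff)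
  with P(1) have "A \<union> B = {..<n}" "A \<inter> B = {}" "A \<noteq> {}" "B \<noteq> {}"
    by (auto simp: partition_on_def disjoint_def)
  then have "A \<noteq> {} \<and> A \<subset> {..<n} \<and> P = {A, {..<n} - A}" using AB by auto
  then show "\<exists>A. A \<noteq> {} \<and> A \<subset> {..<n} \<and> P = {A, {..<n} - A}" ..
next
  assume "\<exists>A. A \<noteq> {} \<and> A \<subset> {..<n} \<and> P = {A, {..<n} - A}"
  then obtain A where A: "A \<noteq> {}" "A \<subset> {..<n}" "P = {A, {..<n} - A}" by blast
  then have "A \<noteq> {..<n} - A" by blast
  with A show "P \<in> bipartitions n"
    by (auto simp: bipartitions_def partition_on_def disjoint_def)
qed

lemma card_bipartitions:
  assumes "n \<ge> 1"
  shows "card (bipartitions n) = 2 ^ (n - 1) - 1"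
proof -
  let ?f = "\<lambda>A. {A, {..<n} - A}"
  have "bipartitions n = ?f ` (Pow {1..<n} - {{}})"
  proof (intro equalityI subsetI)
    fix P assume "P \<in> bipartitions n"
    then obtain A where A: "A \<noteq> {}" "A \<subset> {..<n}" "P = ?f A" by (auto simp: bipartitions_iff)
    show "P \<in> ?f ` (Pow {1..<n} - {{}})"
    proof (cases "0 \<in> A")
      case True
      have "{..<n} - A \<subseteq> {1..<n}"
        using True by (auto simp: Suc_le_eq intro: gr0I)
      moreover have "P = ?f ({..<n} - A)" using A by auto
      ultimately show ?thesis using A(2) by blast
    next
      case False
      then have "A \<subseteq> {1..<n}" using A(2) by (auto simp: Suc_le_eq intro: gr0I)
      then show ?thesis using A by blast
    qed
  next
    fix P assume "P \<in> ?f ` (Pow {1..<n} - {{}})"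
    then obtain A where A: "A \<subseteq> {1..<n}" "A \<noteq> {}" "P = ?f A" by auto
    moreover have "A \<subset> {..<n}"
    proof -
      have "0 \<in> {..<n}" "0 \<notin> A" using assms A(1) by auto
      moreover have "A \<subseteq> {..<n}" using A(1) by auto
      ultimately show ?thesis by blast
    qed
    ultimately show "P \<in> bipartitions n" by (auto simp: bipartitions_iff)
  qed
  moreover have "inj_on ?f (Pow {1..<n} - {{}})"
  proof (rule inj_onI)
    fix A B assume AB: "A \<in> Pow {1..<n} - {{}}" "B \<in> Pow {1..<n} - {{}}" "?f A = ?f B"
    have "0 \<in> {..<n} - B" "0 \<notin> A" using assms AB(1,2) by auto
    then have "A \<noteq> {..<n} - B" by blast
    moreover have "A \<in> {B, {..<n} - B}" using AB(3) by blast
    ultimately show "A = B" by blast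
  qed
  ultimately show ?thesis by (simp add: card_image card_Diff_singleton card_Pow)
qed

end

theory Submission
  imports Defs "HOL-Analysis.L2_Norm"
begin

text \<open>
  The map is linear, so it suffices to treat a state that is a product with respect to one
  bipartition. The summand of that bipartition is then positive semidefinite, because
  transposition preserves positivity on a single tensor factor. Each of the other
  \<open>2^(n-1) - 2\<close> summands is unitarily equivalent to a partial transpose, and a partial transpose
  of any positive semidefinite \<open>\<rho>\<close> is bounded below by \<open>- Tr \<rho> / 2\<close>; the identity term in the map
  compensates exactly for these bounds.

  For the bound one may take \<open>\<rho> = \<psi> \<psi>\<^sup>*\<close>. Reading \<open>\<psi>\<close> and the test vector \<open>v\<close> as matrices and
  putting \<open>W = v\<^sup>T \<psi>\<close>, the quadratic form of the partial transpose is the inner product of \<open>W\<close> with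
  \<open>W\<^sup>T\<close>, which is at least minus the squared norm of the antisymmetric part of \<open>W\<close>. Row by row,
  \<open>\<parallel>x y\<^sup>T - y x\<^sup>T\<parallel> \<le> \<surd>2 \<parallel>x\<parallel> \<parallel>y\<parallel>\<close>, and the triangle and Cauchy-Schwarz inequalities sum
  this up to \<open>\<parallel>W - W\<^sup>T\<parallel>\<^sup>2 \<le> 2 \<parallel>v\<parallel>\<^sup>2 \<parallel>\<psi>\<parallel>\<^sup>2\<close>.
\<close>

subsection \<open>Positive semidefinite kernels on finite sets\<close>

text \<open>An arbitrary index set is allowed because the kernels below are indexed both by numbers
  below \<open>2 ^ n\<close> and by pairs of subsystem indices. As \<open>0 \<le> z\<close> on
  complex numbers includes that \<open>z\<close> is real, Hermitian symmetry is a
  consequence.\<close>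

definition psd_on :: "'a set \<Rightarrow> ('a \<Rightarrow> 'a \<Rightarrow> complex) \<Rightarrow> bool" where
  "psd_on S f \<longleftrightarrow> (\<forall>v. 0 \<le> (\<Sum>i\<in>S. \<Sum>j\<in>S. cnj (v i) * f i j * v j))"

lemma psd_on_cong:
  assumes "\<And>i j. i \<in> S \<Longrightarrow> j \<in> S \<Longrightarrow> f i j = g i j"
  shows "psd_on S f \<longleftrightarrow> psd_on S g"
  unfolding psd_on_def using assms by simp

lemma psd_on_subset:
  assumes "psd_on S f" "T \<subseteq> S" "finite S"
  shows "psd_on T f"
  unfolding psd_on_def
proof
  fix v :: "'a \<Rightarrow> complex"
  \<comment> \<open>Extending the test vector by zero turns the form on \<open>T\<close> into an
    instance of the form on \<open>S\<close>.\<close>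
  let ?v = "\<lambda>i. if i \<in> T then v i else 0"
  have "(\<Sum>j\<in>S. cnj (?v i) * f i j * ?v j) = (\<Sum>j\<in>T. cnj (?v i) * f i j * v j)" for i
    using assms by (intro sum.mono_neutral_cong_right) auto
  then have "(\<Sum>i\<in>S. \<Sum>j\<in>S. cnj (?v i) * f i j * ?v j) = (\<Sum>i\<in>S. \<Sum>j\<in>T. cnj (?v i) * f i j * v j)"
    by simp
  also have "\<dots> = (\<Sum>i\<in>T. \<Sum>j\<in>T. cnj (v i) * f i j * v j)"
    using assms finite_subset[OF assms(2,3)] by (intro sum.mono_neutral_cong_right) auto
  finally show "0 \<le> (\<Sum>i\<in>T. \<Sum>j\<in>T. cnj (v i) * f i j * v j)"
    using spec[OF assms(1)[unfolded psd_on_def], of ?v] by (simp only:)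
qed

lemma psd_on_diag:
  assumes "psd_on S f" "finite S" "i \<in> S"
  shows "0 \<le> f i i"
proof -
  have "psd_on {i} f" using assms by (intro psd_on_subset[OF assms(1)]) auto
  from this[unfolded psd_on_def, rule_format, of "\<lambda>_. 1"] show ?thesis by simp
qed

lemma psd_on_pair:
  assumes "psd_on S f" "finite S" "i \<in> S" "j \<in> S" "i \<noteq> j"
  shows "0 \<le> cnj a * f i i * a + cnj a * f i j * b + cnj b * f j i * a + cnj b * f j j * b"
proof -
  have "psd_on {i, j} f" using assms by (intro psd_on_subset[OF assms(1)]) auto
  from this[unfolded psd_on_def, rule_format, of "\<lambda>k. if k = i then a else b"] assms(5)
  show ?thesis by (simp add: algebra_simps)
qed

lemma psd_on_hermitian:
  assumes "psd_on S f" "finite S" "i \<in> S" "j \<in> S"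
  shows "f j i = cnj (f i j)"
proof (cases "i = j")
  case True
  then show ?thesis using psd_on_diag[OF assms(1,2,3)] by (simp add: complex_eq_iff less_eq_complex_def)
next
  case False
  note p = psd_on_pair[OF assms False]
  \<comment> \<open>The diagonal entries are real. The test vector (1, 1) then makes the imaginary
    parts of \<open>f i j\<close> and \<open>f j i\<close> opposite, and (1, i) makes their real
    parts equal.\<close>
  show ?thesis
    using p[of 1 1] p[of 1 \<i>] psd_on_diag[OF assms(1,2,3)] psd_on_diag[OF assms(1,2,4)]
    by (simp add: complex_eq_iff less_eq_complex_def)
qed

text \<open>With \<open>f i i = 0\<close> the form at the coefficients \<open>- t * f i j\<close>
  and 1 is affine in the real parameter \<open>t\<close>, with slope \<open>- 2 * m\<close>. If
  \<open>f i j\<close> were nonzero, a large \<open>t\<close> would make it negative.\<close>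

lemma psd_on_zero_diag:
  assumes "psd_on S f" "finite S" "i \<in> S" "j \<in> S" "f i i = 0"
  shows "f i j = 0"
proof (rule ccontr)
  assume nz: "f i j \<noteq> 0"
  then have ij: "i \<noteq> j" using assms by auto
  have h: "f j i = cnj (f i j)" by (rule psd_on_hermitian[OF assms(1-4)])
  define m where "m = (cmod (f i j))\<^sup>2"
  have m: "m > 0" "f i j * cnj (f i j) = of_real m"
    using nz by (simp_all add: m_def complex_norm_square del: of_real_power)
  \<comment> \<open>For this \<open>t\<close> the form takes the value -1.\<close>
  define t where "t = (Re (f j j) + 1) / (2 * m)"
  have "0 \<le> cnj (- of_real t * f i j) * f i j + cnj (f i j) * (- of_real t * f i j) + f j j"
    using psd_on_pair[OF assms(1-4) ij, of "- of_real t * f i j" 1] assms(5) h by simp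
  also have "\<dots> = of_real (- 2 * t * m) + f j j"
    using m(2) by (simp add: algebra_simps)
  finally have "0 \<le> - 2 * t * m + Re (f j j)" by (simp add: less_eq_complex_def)
  moreover have "2 * t * m = Re (f j j) + 1" using m(1) by (simp add: t_def)
  ultimately show False by simp
qed

text \<open>Minimising the form over the coordinate at \<open>x\<close>, with the other coordinates
  fixed, leaves exactly the form of the Schur complement.\<close>

lemma psd_on_Schur_complement:
  assumes "psd_on (insert x S) f" "finite S" "x \<notin> S"
  shows "psd_on S (\<lambda>i j. f i j - f i x * f x j / f x x)"
proof (cases "f x x = 0")
  \<comment> \<open>Division by zero yields 0, so the subtracted term vanishes and only a
    restriction of \<open>f\<close> remains.\<close>
  case True
  then show ?thesis using assms by (auto intro: psd_on_subset)
next
  case False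
  show ?thesis
    unfolding psd_on_def
  proof
    fix v :: "'a \<Rightarrow> complex"
    define L where "L = (\<Sum>j\<in>S. f x j * v j)"
    define R where "R = (\<Sum>i\<in>S. cnj (v i) * f i x)"
    \<comment> \<open>The minimiser of the form in the coordinate at \<open>x\<close>, found by
      completing the square.\<close>
    define u where "u = - L / f x x"
    let ?v = "v(x := u)"
    have her: "f i x = cnj (f x i)" if "i \<in> S" for i
      using psd_on_hermitian[OF assms(1), of x i] that assms(2) by simp
    have real: "cnj (f x x) = f x x"
      using psd_on_hermitian[OF assms(1), of x x] assms(2) by simp
    have R: "R = cnj L" unfolding R_def L_def using her by (simp add: mult.commute)
    have ne: "i \<noteq> x" if "i \<in> S" for i using that assms(3) by auto
    have row: "(\<Sum>j\<in>insert x S. cnj (?v i) * f i j * ?v j) =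
       cnj (?v i) * f i x * u + (\<Sum>j\<in>S. cnj (?v i) * f i j * v j)" for i
      using assms(2,3) ne by (simp cong: sum.cong)
    have "(\<Sum>i\<in>insert x S. \<Sum>j\<in>insert x S. cnj (?v i) * f i j * ?v j) =
       cnj u * f x x * u + (\<Sum>j\<in>S. cnj u * f x j * v j)
       + (\<Sum>i\<in>S. cnj (v i) * f i x * u + (\<Sum>j\<in>S. cnj (v i) * f i j * v j))"
      unfolding row using assms(2,3) ne by (simp cong: sum.cong)
    also have "\<dots> = cnj u * f x x * u + cnj u * L + R * u
       + (\<Sum>i\<in>S. \<Sum>j\<in>S. cnj (v i) * f i j * v j)"
      by (simp add: L_def R_def sum.distrib sum_distrib_left sum_distrib_right mult.assoc)
    also have "cnj u * f x x * u + cnj u * L + R * u = - (R * L / f x x)"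
      using False real by (simp add: u_def R field_simps)
    also have "R * L / f x x = (\<Sum>i\<in>S. \<Sum>j\<in>S. cnj (v i) * (f i x * f x j / f x x) * v j)"
      unfolding L_def R_def sum_product sum_divide_distrib
      by (intro sum.cong refl) (simp add: mult_ac)
    finally have "(\<Sum>i\<in>insert x S. \<Sum>j\<in>insert x S. cnj (?v i) * f i j * ?v j) =
       (\<Sum>i\<in>S. \<Sum>j\<in>S. cnj (v i) * (f i j - f i x * f x j / f x x) * v j)"
      by (simp add: algebra_simps sum_subtractf)
    then show "0 \<le> (\<Sum>i\<in>S. \<Sum>j\<in>S. cnj (v i) * (f i j - f i x * f x j / f x x) * v j)"
      using spec[OF assms(1)[unfolded psd_on_def], of ?v] by (simp only:)
  qed
qed

text \<open>Cholesky factorisation by induction: splitting off the rank-one kernel given by the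
  column at \<open>x\<close> leaves the Schur complement, to which the induction hypothesis
  applies.\<close>

lemma psd_on_decomposition:
  assumes "finite S" "psd_on S f"
  shows "\<exists>w. \<forall>i\<in>S. \<forall>j\<in>S. f i j = (\<Sum>k\<in>S. w k i * cnj (w k j))"
  using assms
proof (induction S arbitrary: f rule: finite_induct)
  case (insert x S)
  obtain w where w: "\<And>i j. i \<in> S \<Longrightarrow> j \<in> S \<Longrightarrow>
      f i j - f i x * f x j / f x x = (\<Sum>k\<in>S. w k i * cnj (w k j))"
    using insert.IH[OF psd_on_Schur_complement[OF insert.prems insert.hyps]] by blast
  have fin: "finite (insert x S)" using insert.hyps by simp
  define s where "s = csqrt (f x x)"
  have d: "0 \<le> f x x" using psd_on_diag[OF insert.prems fin] by simp
  have s: "s * cnj s = f x x" "s * s = f x x"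
    using d by (auto simp: s_def less_eq_complex_def complex_eq_iff csqrt_of_real_nonneg
        simp flip: power2_eq_square)
  \<comment> \<open>The new vector is the column at \<open>x\<close> divided by the root of the
    pivot; the old vectors are extended by zero at \<open>x\<close>. If the pivot is 0, the new
    vector is 0 by the convention on division, which fits because the whole row then vanishes by
    \<open>psd_on_zero_diag\<close>.\<close>
  define w' where "w' = (\<lambda>k i. if k = x then f i x / s else if i = x then 0 else w k i)"
  have her: "f j x = cnj (f x j)" if "j \<in> insert x S" for j
    using psd_on_hermitian[OF insert.prems fin, of x j] that by simp
  have zero: "f x j = 0" if "j \<in> insert x S" "f x x = 0" for j
    using psd_on_zero_diag[OF insert.prems fin, of x j] that by simp
  have ne: "k \<noteq> x" if "k \<in> S" for k using that insert.hyps by auto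
  have "f i j = (\<Sum>k\<in>insert x S. w' k i * cnj (w' k j))"
    if "i \<in> insert x S" "j \<in> insert x S" for i j
  proof -
    have "(\<Sum>k\<in>insert x S. w' k i * cnj (w' k j)) = f i x * f x j / f x x
        + (\<Sum>k\<in>S. w' k i * cnj (w' k j))"
      using insert.hyps that(2) her[of j] by (simp add: w'_def s)
    also have "(\<Sum>k\<in>S. w' k i * cnj (w' k j)) =
        (if i = x \<or> j = x then 0 else \<Sum>k\<in>S. w k i * cnj (w k j))"
      using ne by (auto simp: w'_def intro!: sum.cong)
    finally have "(\<Sum>k\<in>insert x S. w' k i * cnj (w' k j)) = f i x * f x j / f x x
        + (if i = x \<or> j = x then 0 else f i j - f i x * f x j / f x x)"
      using that w[of i j] by auto
    then show ?thesis
      using that zero[of i] zero[of j] her[of i] by (auto split: if_splits)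
  qed
  then show ?case by blast
qed simp

section \<open>Sums of rank-one kernels and closure properties\<close>

lemma sum_form_eq_norm_square:
  fixes v w :: "'a \<Rightarrow> complex"
  shows "(\<Sum>i\<in>S. \<Sum>j\<in>S. cnj (v i) * (w i * cnj (w j)) * v j)
    = of_real ((cmod (\<Sum>i\<in>S. cnj (v i) * w i))\<^sup>2)"
  unfolding complex_norm_square cnj_sum sum_product
  by (intro sum.cong refl) simp

lemma form_sum:
  fixes v :: "'a \<Rightarrow> complex"
  shows "(\<Sum>i\<in>S. \<Sum>j\<in>S. cnj (v i) * (\<Sum>k\<in>K. f k i j) * v j)
    = (\<Sum>k\<in>K. \<Sum>i\<in>S. \<Sum>j\<in>S. cnj (v i) * f k i j * v j)"
proof -
  have "(\<Sum>k\<in>K. \<Sum>i\<in>S. \<Sum>j\<in>S. cnj (v i) * f k i j * v j)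
      = (\<Sum>i\<in>S. \<Sum>j\<in>S. \<Sum>k\<in>K. cnj (v i) * f k i j * v j)"
    by (subst sum.swap, intro sum.cong refl, rule sum.swap)
  then show ?thesis by (simp add: sum_distrib_left sum_distrib_right)
qed

text \<open>The form becomes a sum of squared moduli. As a converse of
  \<open>psd_on_decomposition\<close>, this reduces the closure properties below to operations on
  the vectors \<open>w k\<close>.\<close>

lemma psd_onI:
  assumes "\<And>i j. i \<in> S \<Longrightarrow> j \<in> S \<Longrightarrow> f i j = (\<Sum>k\<in>K. w k i * cnj (w k j))"
  shows "psd_on S f"
  unfolding psd_on_def
proof
  fix v :: "'a \<Rightarrow> complex"
  have "(\<Sum>i\<in>S. \<Sum>j\<in>S. cnj (v i) * f i j * v j)
      = (\<Sum>i\<in>S. \<Sum>j\<in>S. cnj (v i) * (\<Sum>k\<in>K. w k i * cnj (w k j)) * v j)"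
    using assms by (intro sum.cong refl) simp
  also have "\<dots> = (\<Sum>k\<in>K. of_real ((cmod (\<Sum>i\<in>S. cnj (v i) * w k i))\<^sup>2))"
    unfolding form_sum sum_form_eq_norm_square ..
  also have "0 \<le> \<dots>" by (intro sum_nonneg) (simp add: less_eq_complex_def del: of_real_power)
  finally show "0 \<le> (\<Sum>i\<in>S. \<Sum>j\<in>S. cnj (v i) * f i j * v j)" .
qed

text \<open>Composing the vectors of a decomposition with \<open>h\<close> decomposes the pulled
  back kernel. Thus \<open>h\<close> may identify indices, as the restriction
  \<open>bits_on A\<close> to a subsystem does.\<close>

lemma psd_on_pullback:
  assumes "psd_on T f" "finite T" "h ` S \<subseteq> T"
  shows "psd_on S (\<lambda>i j. f (h i) (h j))"
proof -
  obtain w where "\<forall>i\<in>T. \<forall>j\<in>T. f i j = (\<Sum>k\<in>T. w k i * cnj (w k j))"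
    using psd_on_decomposition[OF assms(2,1)] by blast
  then show ?thesis
    using assms(3) by (intro psd_onI[where K = T and w = "\<lambda>k i. w k (h i)"]) auto
qed

text \<open>Conjugating the vectors of a decomposition transposes the kernel.\<close>

lemma psd_on_transpose:
  assumes "psd_on S f" "finite S"
  shows "psd_on S (\<lambda>i j. f j i)"
proof -
  obtain w where "\<forall>i\<in>S. \<forall>j\<in>S. f i j = (\<Sum>k\<in>S. w k i * cnj (w k j))"
    using psd_on_decomposition[OF assms(2,1)] by blast
  then show ?thesis
    by (intro psd_onI[where K = S and w = "\<lambda>k i. cnj (w k i)"]) (auto simp: mult.commute)
qed

text \<open>Schur product theorem: the pointwise products of the vectors of two decompositions,
  indexed by pairs, decompose the entrywise product.\<close>

lemma psd_on_mult:
  assumes "psd_on S f" "psd_on S g" "finite S"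
  shows "psd_on S (\<lambda>i j. f i j * g i j)"
proof -
  obtain w u where "\<forall>i\<in>S. \<forall>j\<in>S. f i j = (\<Sum>k\<in>S. w k i * cnj (w k j))"
      "\<forall>i\<in>S. \<forall>j\<in>S. g i j = (\<Sum>k\<in>S. u k i * cnj (u k j))"
    using psd_on_decomposition[OF assms(3,1)] psd_on_decomposition[OF assms(3,2)] by blast
  then have "f i j * g i j
      = (\<Sum>k\<in>S \<times> S. (w (fst k) i * cnj (w (fst k) j)) * (u (snd k) i * cnj (u (snd k) j)))"
    if "i \<in> S" "j \<in> S" for i j
    using that by (simp add: sum_product sum.cartesian_product case_prod_unfold)
  then show ?thesis
    by (intro psd_onI[where K = "S \<times> S" and w = "\<lambda>k i. w (fst k) i * u (snd k) i"])
      (simp add: mult_ac)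
qed

lemma psd_on_conic_combination:
  fixes c :: "'k \<Rightarrow> real" and f :: "'k \<Rightarrow> 'a \<Rightarrow> 'a \<Rightarrow> complex"
  assumes "\<And>k. k \<in> K \<Longrightarrow> 0 \<le> c k" "\<And>k. k \<in> K \<Longrightarrow> psd_on S (f k)"
  shows "psd_on S (\<lambda>i j. \<Sum>k\<in>K. of_real (c k) * f k i j)"
  unfolding psd_on_def
proof
  fix v :: "'a \<Rightarrow> complex"
  have "(\<Sum>i\<in>S. \<Sum>j\<in>S. cnj (v i) * (\<Sum>k\<in>K. of_real (c k) * f k i j) * v j)
      = (\<Sum>k\<in>K. of_real (c k) * (\<Sum>i\<in>S. \<Sum>j\<in>S. cnj (v i) * f k i j * v j))"
    unfolding form_sum by (simp add: sum_distrib_left mult_ac)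
  also have "0 \<le> \<dots>"
  proof (rule sum_nonneg)
    fix k assume k: "k \<in> K"
    have "0 \<le> complex_of_real (c k)" using assms(1)[OF k] by (simp add: less_eq_complex_def)
    moreover have "0 \<le> (\<Sum>i\<in>S. \<Sum>j\<in>S. cnj (v i) * f k i j * v j)"
      using assms(2)[OF k] unfolding psd_on_def ..
    ultimately show "0 \<le> of_real (c k) * (\<Sum>i\<in>S. \<Sum>j\<in>S. cnj (v i) * f k i j * v j)"
      by (rule mult_nonneg_nonneg)
  qed
  finally show "0 \<le> (\<Sum>i\<in>S. \<Sum>j\<in>S. cnj (v i) * (\<Sum>k\<in>K. of_real (c k) * f k i j) * v j)" .
qed

subsection \<open>The lower bound for partial transposes\<close>

text \<open>Expanding the squares gives two equal main terms and the cross term -2 |Z|^2, where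
  \<open>Z\<close> is the inner product of \<open>x\<close> and \<open>y\<close>. Its sign yields
  the factor 2, where the triangle inequality would only give 4.\<close>

lemma antisym_product_bound:
  fixes x y :: "'b \<Rightarrow> complex"
  shows "(\<Sum>b\<in>J. \<Sum>b'\<in>J. (cmod (x b * y b' - x b' * y b))\<^sup>2)
    \<le> 2 * (\<Sum>b\<in>J. (cmod (x b))\<^sup>2) * (\<Sum>b\<in>J. (cmod (y b))\<^sup>2)"
proof -
  have cm: "(cmod (p - q))\<^sup>2 = (cmod p)\<^sup>2 + (cmod q)\<^sup>2 - 2 * Re (p * cnj q)" for p q
    unfolding cmod_power2 by (simp add: power2_eq_square algebra_simps)
  define Z where "Z = (\<Sum>b\<in>J. x b * cnj (y b))"
  have "(\<Sum>b\<in>J. \<Sum>b'\<in>J. Re (x b * y b' * cnj (x b' * y b))) = Re (Z * cnj Z)"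
    unfolding Z_def cnj_sum sum_product Re_sum
    by (intro sum.cong refl arg_cong[of _ _ Re]) (simp only: complex_cnj_mult complex_cnj_cnj mult_ac)
  then have Z: "0 \<le> (\<Sum>b\<in>J. \<Sum>b'\<in>J. Re (x b * y b' * cnj (x b' * y b)))"
    by simp
  have "(\<Sum>b\<in>J. \<Sum>b'\<in>J. (cmod (x b * y b'))\<^sup>2)
      = (\<Sum>b\<in>J. (cmod (x b))\<^sup>2) * (\<Sum>b\<in>J. (cmod (y b))\<^sup>2)"
    by (simp add: sum_product norm_mult power_mult_distrib)
  moreover have "(\<Sum>b\<in>J. \<Sum>b'\<in>J. (cmod (x b' * y b))\<^sup>2)
      = (\<Sum>b\<in>J. (cmod (x b))\<^sup>2) * (\<Sum>b\<in>J. (cmod (y b))\<^sup>2)"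
    by (subst sum.swap) (simp add: sum_product norm_mult power_mult_distrib)
  ultimately show ?thesis
    using Z by (simp only: cm sum.distrib sum_subtractf sum_distrib_left[symmetric])
qed

text \<open>Triangle inequality for the l2 norm of a finite sum of vectors, in squared form: the
  square is expanded and Cauchy-Schwarz is applied to each cross term.\<close>

lemma sum_square_le_L2_set:
  fixes g :: "'a \<Rightarrow> 'b \<Rightarrow> complex"
  shows "(\<Sum>p\<in>S. (cmod (\<Sum>a\<in>I. g a p))\<^sup>2) \<le> (\<Sum>a\<in>I. L2_set (\<lambda>p. cmod (g a p)) S)\<^sup>2"
proof -
  have "(\<Sum>p\<in>S. (cmod (\<Sum>a\<in>I. g a p))\<^sup>2) \<le> (\<Sum>p\<in>S. (\<Sum>a\<in>I. cmod (g a p))\<^sup>2)"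
    by (intro sum_mono power_mono norm_sum) auto
  also have "\<dots> = (\<Sum>p\<in>S. \<Sum>a\<in>I. \<Sum>a'\<in>I. cmod (g a p) * cmod (g a' p))"
    by (simp add: power2_eq_square sum_product)
  also have "\<dots> = (\<Sum>a\<in>I. \<Sum>a'\<in>I. \<Sum>p\<in>S. cmod (g a p) * cmod (g a' p))"
    by (subst sum.swap, intro sum.cong refl, rule sum.swap)
  also have "\<dots> \<le> (\<Sum>a\<in>I. \<Sum>a'\<in>I. L2_set (\<lambda>p. cmod (g a p)) S * L2_set (\<lambda>p. cmod (g a' p)) S)"
    using L2_set_mult_ineq[of "\<lambda>p. cmod (g _ p)" "\<lambda>p. cmod (g _ p)" S]
    by (intro sum_mono) auto
  also have "\<dots> = (\<Sum>a\<in>I. L2_set (\<lambda>p. cmod (g a p)) S)\<^sup>2"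
    by (simp add: power2_eq_square sum_product)
  finally show ?thesis .
qed

text \<open>With \<open>v\<close> and \<open>\<psi>\<close> for \<open>x\<close> and
  \<open>y\<close>, the inner sum is an entry of W - W^T. Each row \<open>a\<close> is handled by
  \<open>antisym_product_bound\<close>, the rows are added in l2 norm, and Cauchy-Schwarz over the
  row norms \<open>nx\<close> and \<open>ny\<close> finishes.\<close>

lemma sum_antisym_product_bound:
  fixes x y :: "'a \<times> 'b \<Rightarrow> complex"
  shows "(\<Sum>b\<in>J. \<Sum>b'\<in>J. (cmod (\<Sum>a\<in>I. x (a, b) * y (a, b') - x (a, b') * y (a, b)))\<^sup>2)
    \<le> 2 * (\<Sum>p\<in>I \<times> J. (cmod (x p))\<^sup>2) * (\<Sum>p\<in>I \<times> J. (cmod (y p))\<^sup>2)"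
proof -
  define g where "g = (\<lambda>a (b, b'). x (a, b) * y (a, b') - x (a, b') * y (a, b))"
  define nx where "nx = (\<lambda>a. L2_set (\<lambda>b. cmod (x (a, b))) J)"
  define ny where "ny = (\<lambda>a. L2_set (\<lambda>b. cmod (y (a, b))) J)"
  have sq: "(nx a)\<^sup>2 = (\<Sum>b\<in>J. (cmod (x (a, b)))\<^sup>2)" "(ny a)\<^sup>2 = (\<Sum>b\<in>J. (cmod (y (a, b)))\<^sup>2)" for a
    by (simp_all add: nx_def ny_def L2_set_def sum_nonneg)
  have nn: "0 \<le> nx a" "0 \<le> ny a" for a by (simp_all add: nx_def ny_def)
  have L: "L2_set (\<lambda>p. cmod (g a p)) (J \<times> J) \<le> sqrt 2 * (nx a * ny a)" for a
  proof -
    have "(\<Sum>p\<in>J \<times> J. (cmod (g a p))\<^sup>2) \<le> 2 * (nx a)\<^sup>2 * (ny a)\<^sup>2"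
      unfolding sq using antisym_product_bound[where x = "\<lambda>b. x (a, b)" and y = "\<lambda>b. y (a, b)" and J = J]
      by (simp add: g_def sum.cartesian_product case_prod_unfold)
    then have "L2_set (\<lambda>p. cmod (g a p)) (J \<times> J) \<le> sqrt (2 * (nx a)\<^sup>2 * (ny a)\<^sup>2)"
      by (simp add: L2_set_def)
    then show ?thesis using nn[of a] by (simp add: real_sqrt_mult)
  qed
  have "(\<Sum>b\<in>J. \<Sum>b'\<in>J. (cmod (\<Sum>a\<in>I. x (a, b) * y (a, b') - x (a, b') * y (a, b)))\<^sup>2)
      = (\<Sum>p\<in>J \<times> J. (cmod (\<Sum>a\<in>I. g a p))\<^sup>2)"
    by (simp add: g_def sum.cartesian_product case_prod_unfold)
  also have "\<dots> \<le> (\<Sum>a\<in>I. L2_set (\<lambda>p. cmod (g a p)) (J \<times> J))\<^sup>2"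
    by (rule sum_square_le_L2_set)
  also have "\<dots> \<le> (\<Sum>a\<in>I. sqrt 2 * (nx a * ny a))\<^sup>2"
    by (intro power_mono sum_mono L sum_nonneg) simp
  also have "\<dots> = 2 * (\<Sum>a\<in>I. nx a * ny a)\<^sup>2"
    by (simp add: sum_distrib_left[symmetric] power_mult_distrib)
  also have "(\<Sum>a\<in>I. nx a * ny a)\<^sup>2 \<le> (L2_set nx I * L2_set ny I)\<^sup>2"
    using L2_set_mult_ineq[of nx ny I] nn by (intro power_mono sum_nonneg) (simp_all)
  also have "(L2_set nx I * L2_set ny I)\<^sup>2 =
      (\<Sum>p\<in>I \<times> J. (cmod (x p))\<^sup>2) * (\<Sum>p\<in>I \<times> J. (cmod (y p))\<^sup>2)"
    by (simp add: power_mult_distrib L2_set_def sum_nonneg sq sum.cartesian_product case_prod_unfold)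
  finally show ?thesis by simp
qed

lemma partial_transpose_rank_one:
  fixes v \<psi> :: "'a \<times> 'b \<Rightarrow> complex"
  shows "0 \<le> (\<Sum>p\<in>I \<times> J. \<Sum>q\<in>I \<times> J.
      cnj (v p) * (\<psi> (fst q, snd p) * cnj (\<psi> (fst p, snd q))) * v q)
    + of_real ((\<Sum>p\<in>I \<times> J. (cmod (\<psi> p))\<^sup>2) * (\<Sum>p\<in>I \<times> J. (cmod (v p))\<^sup>2) / 2)"
    (is "0 \<le> ?F + of_real ?N")
proof -
  \<comment> \<open>Grouping the fourfold sum by the second components lets both sums over first
    components factor, one into \<open>cnj (W b b')\<close> and the other into
    \<open>W b' b\<close>.\<close>
  define W where "W = (\<lambda>b b'. \<Sum>a\<in>I. v (a, b) * \<psi> (a, b'))"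
  have "?F = (\<Sum>a\<in>I. \<Sum>b\<in>J. \<Sum>a'\<in>I. \<Sum>b'\<in>J.
      cnj (v (a, b)) * (\<psi> (a', b) * cnj (\<psi> (a, b'))) * v (a', b'))"
    by (simp add: sum.cartesian_product[symmetric] sum.cartesian_product' case_prod_unfold)
  also have "\<dots> = (\<Sum>b\<in>J. \<Sum>a\<in>I. \<Sum>b'\<in>J. \<Sum>a'\<in>I.
      cnj (v (a, b)) * (\<psi> (a', b) * cnj (\<psi> (a, b'))) * v (a', b'))"
    by (subst sum.swap, intro sum.cong refl, rule sum.swap)
  also have "\<dots> = (\<Sum>b\<in>J. \<Sum>b'\<in>J. \<Sum>a\<in>I. \<Sum>a'\<in>I.
      cnj (v (a, b)) * (\<psi> (a', b) * cnj (\<psi> (a, b'))) * v (a', b'))"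
    by (intro sum.cong refl, rule sum.swap)
  also have "\<dots> = (\<Sum>b\<in>J. \<Sum>b'\<in>J. cnj (W b b') * W b' b)"
    unfolding W_def
    by (intro sum.cong refl, simp only: cnj_sum sum_product) (intro sum.cong refl, simp)
  finally have F: "?F = (\<Sum>b\<in>J. \<Sum>b'\<in>J. cnj (W b b') * W b' b)" .
  \<comment> \<open>Exchanging the names \<open>b\<close> and \<open>b'\<close> conjugates the form,
    so it is real.\<close>
  have "cnj ?F = (\<Sum>b\<in>J. \<Sum>b'\<in>J. cnj (W b' b) * W b b')"
    unfolding F by (simp add: mult.commute)
  also have "\<dots> = ?F" unfolding F by (rule sum.swap)
  finally have "Im (cnj ?F) = Im ?F" by (rule arg_cong)
  then have im: "Im ?F = 0" unfolding cnj.sel by linarith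
  \<comment> \<open>Polarisation, with the nonnegative square of the sum dropped.\<close>
  have pol: "- (cmod (z - w))\<^sup>2 / 4 \<le> Re (cnj z * w)" for z w
  proof -
    have "Re (cnj z * w) = ((cmod (z + w))\<^sup>2 - (cmod (z - w))\<^sup>2) / 4"
      unfolding cmod_power2 by (simp add: power2_eq_square algebra_simps)
    then show ?thesis by (simp only:) (intro divide_right_mono, simp_all)
  qed
  have D: "W b b' - W b' b = (\<Sum>a\<in>I. v (a, b) * \<psi> (a, b') - v (a, b') * \<psi> (a, b))" for b b'
    by (simp add: W_def sum_subtractf)
  \<comment> \<open>The factor 2 of the antisymmetric bound over the 4 of polarisation gives the
    constant 1/2.\<close>
  have "- ?N \<le> - (\<Sum>b\<in>J. \<Sum>b'\<in>J. (cmod (W b b' - W b' b))\<^sup>2) / 4"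
    using sum_antisym_product_bound[of v \<psi> I J] unfolding D by (simp add: mult_ac)
  also have "\<dots> = (\<Sum>b\<in>J. \<Sum>b'\<in>J. - (cmod (W b b' - W b' b))\<^sup>2 / 4)"
    by (simp add: sum_negf sum_divide_distrib)
  also have "\<dots> \<le> (\<Sum>b\<in>J. \<Sum>b'\<in>J. Re (cnj (W b b') * W b' b))"
    by (intro sum_mono pol)
  also have "\<dots> = Re ?F" unfolding F by (simp only: Re_sum)
  finally show ?thesis using im by (simp add: less_eq_complex_def)
qed

text \<open>Both terms are linear in \<open>f\<close>, so a decomposition of \<open>f\<close>
  reduces the claim to the rank-one case; the diagonal sum of \<open>f\<close> is the total squared
  norm of the vectors.\<close>

lemma partial_transpose_bound:
  fixes v :: "'a \<times> 'b \<Rightarrow> complex"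
  assumes "finite I" "finite J" "psd_on (I \<times> J) f"
  shows "0 \<le> (\<Sum>p\<in>I \<times> J. \<Sum>q\<in>I \<times> J. cnj (v p) * f (fst q, snd p) (fst p, snd q) * v q)
    + (\<Sum>p\<in>I \<times> J. f p p) * of_real (\<Sum>p\<in>I \<times> J. (cmod (v p))\<^sup>2) / 2"
proof -
  define S where "S = I \<times> J"
  define N where "N = (\<Sum>p\<in>S. (cmod (v p))\<^sup>2)"
  obtain w where w: "\<And>p q. p \<in> S \<Longrightarrow> q \<in> S \<Longrightarrow> f p q = (\<Sum>k\<in>S. w k p * cnj (w k q))"
    using psd_on_decomposition[OF _ assms(3)] assms(1,2) unfolding S_def by blast
  have "(\<Sum>p\<in>S. \<Sum>q\<in>S. cnj (v p) * f (fst q, snd p) (fst p, snd q) * v q)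
      = (\<Sum>p\<in>S. \<Sum>q\<in>S. cnj (v p) * (\<Sum>k\<in>S. w k (fst q, snd p) * cnj (w k (fst p, snd q))) * v q)"
    by (intro sum.cong refl arg_cong2[of _ _ _ _ "(*)"] w) (auto simp: S_def)
  also have "\<dots> = (\<Sum>k\<in>S. \<Sum>p\<in>S. \<Sum>q\<in>S. cnj (v p) * (w k (fst q, snd p) * cnj (w k (fst p, snd q))) * v q)"
    by (rule form_sum)
  finally have 1: "(\<Sum>p\<in>S. \<Sum>q\<in>S. cnj (v p) * f (fst q, snd p) (fst p, snd q) * v q) = \<dots>" .
  have "(\<Sum>p\<in>S. f p p) = (\<Sum>p\<in>S. \<Sum>k\<in>S. of_real ((cmod (w k p))\<^sup>2))"
    using w by (simp add: complex_norm_square del: of_real_power)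
  also have "\<dots> = (\<Sum>k\<in>S. \<Sum>p\<in>S. of_real ((cmod (w k p))\<^sup>2))" by (rule sum.swap)
  finally have 2: "(\<Sum>p\<in>S. f p p) * of_real N / 2
      = (\<Sum>k\<in>S. of_real ((\<Sum>p\<in>S. (cmod (w k p))\<^sup>2) * N / 2))"
    by (simp add: sum_distrib_right sum_divide_distrib)
  show ?thesis
    unfolding S_def[symmetric] N_def[symmetric] 1 2 sum.distrib[symmetric]
    unfolding N_def S_def by (intro sum_nonneg partial_transpose_rank_one)
qed

subsection \<open>Operators on qubits\<close>

lemma psd_iff_psd_on:
  "psd d M \<longleftrightarrow> M \<in> carrier_mat d d \<and> psd_on {..<d} (\<lambda>i j. M $$ (i, j))"
proof -
  have form: "(M *\<^sub>v v) \<bullet>c v = (\<Sum>i<d. \<Sum>j<d. cnj (v $ i) * M $$ (i, j) * v $ j)"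
    if "M \<in> carrier_mat d d" "v \<in> carrier_vec d" for v
    using that by (auto simp: scalar_prod_def sum_distrib_left sum_distrib_right mult_ac
        lessThan_atLeast0 intro!: sum.cong)
  show ?thesis
  proof (cases "M \<in> carrier_mat d d")
    case True
    have "(\<forall>v\<in>carrier_vec d. 0 \<le> (\<Sum>i<d. \<Sum>j<d. cnj (v $ i) * M $$ (i, j) * v $ j))
      \<longleftrightarrow> (\<forall>v. 0 \<le> (\<Sum>i<d. \<Sum>j<d. cnj (v i) * M $$ (i, j) * v j))" (is "?L \<longleftrightarrow> ?R")
    proof
      assume L: ?L
      show ?R
      proof
        fix v :: "nat \<Rightarrow> complex"
        show "0 \<le> (\<Sum>i<d. \<Sum>j<d. cnj (v i) * M $$ (i, j) * v j)"
          using bspec[OF L, of "vec d v"] by simp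
      qed
    qed blast
    with True form show ?thesis by (simp add: psd_def psd_on_def)
  qed (simp add: psd_def)
qed

text \<open>The permutation of the computational basis effected by
  \<open>sigma_x_pow m\<close>.\<close>

definition flip_bits :: "nat \<Rightarrow> nat \<Rightarrow> nat" where
  "flip_bits m i = semiring_bit_operations_class.xor i (mask m)"

lemma flip_bits_flip_bits [simp]: "flip_bits m (flip_bits m i) = i"
  by (simp add: flip_bits_def xor.assoc)

lemma flip_bits_less: "i < 2 ^ m \<Longrightarrow> flip_bits m i < 2 ^ m"
  unfolding flip_bits_def take_bit_nat_eq_self_iff[symmetric]
  by (simp add: take_bit_xor)

lemma sigma_x_pow_index:
  assumes "i < 2 ^ m" "j < 2 ^ m"
  shows "sigma_x_pow m $$ (i, j) = of_bool (j = flip_bits m i)"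
proof -
  \<comment> \<open>Bits from position \<open>m\<close> on vanish in both numbers, so only the
    lowest \<open>m\<close> bits need comparing.\<close>
  have eq: "j = flip_bits m i \<longleftrightarrow> (\<forall>k<m. bit i k \<noteq> bit j k)"
    using not_bit_of_less[OF assms(1)] not_bit_of_less[OF assms(2)]
    by (auto simp: bit_eq_iff flip_bits_def bit_xor_iff bit_mask_iff not_less)
  have entry: "sigma_x $$ (of_bool b, of_bool b') = (if b \<noteq> b' then 1 else 0)" for b b'
    by (cases b; cases b') (simp_all add: sigma_x_def mat_of_rows_list_def)
  show ?thesis
    using assms unfolding eq sigma_x_pow_def by (auto simp: entry prod_zero_iff)
qed

lemma sigma_x_conj_index:
  assumes "X \<in> carrier_mat (2 ^ m) (2 ^ m)" "i < 2 ^ m" "j < 2 ^ m"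
  shows "sigma_x_conj m X $$ (i, j) = X $$ (flip_bits m i, flip_bits m j)"
proof -
  have sym: "j = flip_bits m k \<longleftrightarrow> k = flip_bits m j" for j k by auto
  have [simp]: "sigma_x_pow m \<in> carrier_mat (2 ^ m) (2 ^ m)" by (simp add: sigma_x_pow_def)
  have l: "(sigma_x_pow m * X) $$ (i, k) = X $$ (flip_bits m i, k)" if "k < 2 ^ m" for k
  proof -
    have "(sigma_x_pow m * X) $$ (i, k) = (\<Sum>l<2 ^ m. sigma_x_pow m $$ (i, l) * X $$ (l, k))"
      using assms that carrier_matD[of "sigma_x_pow m" "2 ^ m" "2 ^ m"]
      by (auto simp: scalar_prod_def lessThan_atLeast0)
    also have "\<dots> = (\<Sum>l<2 ^ m. if l = flip_bits m i then X $$ (l, k) else 0)"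
      using assms by (intro sum.cong) (auto simp: sigma_x_pow_index)
    finally show ?thesis using flip_bits_less[OF assms(2)] by simp
  qed
  have "sigma_x_conj m X $$ (i, j)
      = (\<Sum>k<2 ^ m. (sigma_x_pow m * X) $$ (i, k) * sigma_x_pow m $$ (k, j))"
    using assms carrier_matD[of "sigma_x_pow m" "2 ^ m" "2 ^ m"]
    unfolding sigma_x_conj_def by (auto simp: scalar_prod_def lessThan_atLeast0)
  also have "\<dots> = (\<Sum>k<2 ^ m. if k = flip_bits m j then X $$ (flip_bits m i, k) else 0)"
    using assms by (intro sum.cong) (auto simp: sigma_x_pow_index l sym[of j])
  finally show ?thesis using flip_bits_less[OF assms(3)] by simp
qed

section \<open>The summands of the map as relabelled partial transposes\<close>

lemma tensor_id_map_index:
  assumes "i < 2 ^ n" "j < 2 ^ n"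
  shows "tensor_id_map n A (sigma_x_conj (card A) \<circ> transpose_mat) X $$ (i, j)
    = X $$ (merge_bits n A (flip_bits (card A) (bits_on A j)) (bits_on ({..<n} - A) i),
            merge_bits n A (flip_bits (card A) (bits_on A i)) (bits_on ({..<n} - A) j))"
  using assms unfolding tensor_id_map_def
  by (simp add: sigma_x_conj_index bits_on_less flip_bits_less)

lemma bij_betw_merge_bits:
  assumes "A \<subseteq> {..<n}"
  shows "bij_betw (\<lambda>p. merge_bits n A (fst p) (snd p))
    ({..<2 ^ card A} \<times> {..<2 ^ card ({..<n} - A)}) {..<2 ^ n}"
  using assms
  by (intro bij_betw_byWitness[where f' = "\<lambda>i. (bits_on A i, bits_on ({..<n} - A) i)"])
    (auto simp: bits_on_merge_bits bits_on_compl_merge_bits merge_bits_bits_on merge_bits_less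
      bits_on_less)

lemma tensor_id_map_form_bound:
  assumes A: "A \<subseteq> {..<n}" and X: "psd (2 ^ n) X"
  shows "0 \<le> (\<Sum>i<2 ^ n. \<Sum>j<2 ^ n. cnj (v i)
      * tensor_id_map n A (sigma_x_conj (card A) \<circ> transpose_mat) X $$ (i, j) * v j)
    + tr X * of_real (\<Sum>i<2 ^ n. (cmod (v i))\<^sup>2) / 2"
proof -
  define S :: "(nat \<times> nat) set" where "S = {..<2 ^ card A} \<times> {..<2 ^ card ({..<n} - A)}"
  define m where "m = (\<lambda>p. merge_bits n A (fst p) (snd p))"
  \<comment> \<open>Two labellings of the basis by pairs: \<open>m\<close> for the entries of
    \<open>X\<close>, and \<open>h\<close> with the flip on \<open>A\<close> absorbed for the
    entries of the image. Between them the summand is a plain partial transpose, tested on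
    \<open>v \<circ> h\<close>; both are bijections, so trace and norm are preserved.\<close>
  define h where "h = (\<lambda>p. merge_bits n A (flip_bits (card A) (fst p)) (snd p))"
  have m: "bij_betw m S {..<2 ^ n}"
    unfolding m_def S_def by (rule bij_betw_merge_bits[OF A])
  have "bij_betw (\<lambda>p. (flip_bits (card A) (fst p), snd p)) S S"
    by (rule bij_betw_byWitness[where f' = "\<lambda>p. (flip_bits (card A) (fst p), snd p)"])
      (auto simp: S_def flip_bits_less)
  from bij_betw_trans[OF this m] have h: "bij_betw h S {..<2 ^ n}"
    by (simp add: h_def m_def comp_def)
  let ?f = "\<lambda>p q. X $$ (m p, m q)"
  have psd: "psd_on S ?f"
    using X m by (intro psd_on_pullback[of "{..<2 ^ n}" "\<lambda>i j. X $$ (i, j)" m])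
      (simp_all add: psd_iff_psd_on bij_betw_def)
  have entry: "tensor_id_map n A (sigma_x_conj (card A) \<circ> transpose_mat) X $$ (h p, h q)
      = ?f (fst q, snd p) (fst p, snd q)" if "p \<in> S" "q \<in> S" for p q
  proof -
    have "h p < 2 ^ n" "h q < 2 ^ n" by (simp_all add: h_def merge_bits_less)
    then show ?thesis
      using that A
      by (simp only: tensor_id_map_index) (auto simp: h_def m_def S_def bits_on_merge_bits
          bits_on_compl_merge_bits flip_bits_less)
  qed
  have "(\<Sum>i<2 ^ n. \<Sum>j<2 ^ n. cnj (v i)
      * tensor_id_map n A (sigma_x_conj (card A) \<circ> transpose_mat) X $$ (i, j) * v j)
    = (\<Sum>p\<in>S. \<Sum>q\<in>S. cnj (v (h p)) * ?f (fst q, snd p) (fst p, snd q) * v (h q))"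
    unfolding sum.reindex_bij_betw[OF h, symmetric]
    using entry by (intro sum.cong refl) simp
  moreover have "tr X = (\<Sum>p\<in>S. ?f p p)"
    using X unfolding sum.reindex_bij_betw[OF m, of "\<lambda>i. X $$ (i, i)"] tr_def
    by (auto simp: psd_def)
  moreover have "(\<Sum>i<2 ^ n. (cmod (v i))\<^sup>2) = (\<Sum>p\<in>S. (cmod (v (h p)))\<^sup>2)"
    by (rule sum.reindex_bij_betw[OF h, symmetric])
  ultimately show ?thesis
    using partial_transpose_bound[of "{..<2 ^ card A}" "{..<2 ^ card ({..<n} - A)}" ?f "v \<circ> h"] psd
    unfolding S_def[symmetric] by simp
qed

section \<open>Positivity of tensor products\<close>

lemma psd_on_bits_on:
  assumes "psd (2 ^ card A) X"
  shows "psd_on S (\<lambda>i j. X $$ (bits_on A i, bits_on A j))"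
  using assms by (intro psd_on_pullback[of "{..<2 ^ card A}" "\<lambda>i j. X $$ (i, j)" "bits_on A"])
    (auto simp: psd_iff_psd_on bits_on_less)

text \<open>A tensor product is the entrywise product of the two factors pulled back along the
  restrictions to the subsystems, so the Schur product theorem applies.\<close>

lemma psd_tensor_op:
  assumes "psd (2 ^ card A) X" "psd (2 ^ card ({..<n} - A)) Y"
  shows "psd (2 ^ n) (tensor_op n A X Y)"
proof -
  have "psd_on {..<2 ^ n} (\<lambda>i j. X $$ (bits_on A i, bits_on A j)
      * Y $$ (bits_on ({..<n} - A) i, bits_on ({..<n} - A) j))"
    using assms by (intro psd_on_mult psd_on_bits_on) auto
  also have "?this \<longleftrightarrow> psd_on {..<2 ^ n} (\<lambda>i j. tensor_op n A X Y $$ (i, j))"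
    by (rule psd_on_cong) (simp add: tensor_op_def)
  finally show ?thesis by (simp add: psd_iff_psd_on tensor_op_def)
qed

text \<open>Only the factor on \<open>A\<close> changes: it is fully transposed and its basis
  relabelled, and both operations preserve positivity.\<close>

lemma psd_tensor_id_map_tensor_op:
  assumes A: "A \<subseteq> {..<n}" and XY: "psd (2 ^ card A) X" "psd (2 ^ card ({..<n} - A)) Y"
  shows "psd (2 ^ n) (tensor_id_map n A (sigma_x_conj (card A) \<circ> transpose_mat) (tensor_op n A X Y))"
proof -
  let ?L = "sigma_x_conj (card A) \<circ> transpose_mat"
  have carr: "X \<in> carrier_mat (2 ^ card A) (2 ^ card A)" using XY by (simp add: psd_def)
  have L: "?L Z \<in> carrier_mat (2 ^ card A) (2 ^ card A)" for Z
    by (rule carrier_matI) (simp_all add: sigma_x_conj_def sigma_x_pow_def)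
  have entry: "?L Z $$ (i, j) = Z $$ (flip_bits (card A) j, flip_bits (card A) i)"
    if "Z \<in> carrier_mat (2 ^ card A) (2 ^ card A)" "i < 2 ^ card A" "j < 2 ^ card A" for Z i j
    using that by (simp add: sigma_x_conj_index flip_bits_less)
  \<comment> \<open>Each block of the product is an entry of \<open>Y\<close> times
    \<open>X\<close>; homogeneity pulls that scalar out of the map.\<close>
  have hom: "?L (z \<cdot>\<^sub>m X) = z \<cdot>\<^sub>m ?L X" for z
  proof (rule eq_matI)
    fix i j assume "i < dim_row (z \<cdot>\<^sub>m ?L X)" "j < dim_col (z \<cdot>\<^sub>m ?L X)"
    then have ij: "i < 2 ^ card A" "j < 2 ^ card A" using L[of X] by auto
    then have "(z \<cdot>\<^sub>m ?L X) $$ (i, j) = z * ?L X $$ (i, j)"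
      using L[of X] by (intro index_smult_mat) auto
    moreover have "?L (z \<cdot>\<^sub>m X) $$ (i, j) = (z \<cdot>\<^sub>m X) $$ (flip_bits (card A) j, flip_bits (card A) i)"
      using carr by (intro entry ij) simp
    ultimately show "?L (z \<cdot>\<^sub>m X) $$ (i, j) = (z \<cdot>\<^sub>m ?L X) $$ (i, j)"
      using entry[OF carr ij] carr ij by (simp add: flip_bits_less)
  qed (use L[of X] L[of "z \<cdot>\<^sub>m X"] in auto)
  have "psd_on {..<2 ^ card A} (\<lambda>i j. X $$ (flip_bits (card A) j, flip_bits (card A) i))"
    using XY(1)
    by (intro psd_on_pullback[of "{..<2 ^ card A}" "\<lambda>i j. X $$ (j, i)" "flip_bits (card A)"]
        psd_on_transpose[of _ "\<lambda>i j. X $$ (i, j)"])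
      (auto simp: psd_iff_psd_on flip_bits_less)
  also have "?this \<longleftrightarrow> psd_on {..<2 ^ card A} (\<lambda>i j. ?L X $$ (i, j))"
    by (rule psd_on_cong) (simp only: entry[OF carr] lessThan_iff)
  finally have "psd (2 ^ card A) (?L X)" using L by (simp add: psd_iff_psd_on)
  then show ?thesis
    using tensor_id_map_tensor_op[where \<Lambda> = ?L, OF A carr L hom] XY(2) by (metis psd_tensor_op)
qed

section \<open>The map on product states and on mixtures\<close>

lemma tensor_op_commute:
  assumes "A \<subseteq> {..<n}"
  shows "tensor_op n ({..<n} - A) Y X = tensor_op n A X Y"
proof -
  have "{..<n} - ({..<n} - A) = A" using assms by auto
  then show ?thesis by (simp add: tensor_op_def mult.commute)
qed

lemma Phi_Tx_index:
  assumes "i < 2 ^ n" "j < 2 ^ n"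
  shows "Phi_Tx n c X $$ (i, j) = (\<Sum>P\<in>bipartitions n.
      tensor_id_map n (c P) (sigma_x_conj (card (c P)) \<circ> transpose_mat) X $$ (i, j))
    + (2 ^ (n - 1) - 2) / 2 * tr X * of_bool (i = j)"
  using assms by (simp add: Phi_Tx_def)

lemma psd_Phi_Tx_product_state:
  assumes n: "n \<ge> 2" and c: "\<And>P. P \<in> bipartitions n \<Longrightarrow> c P \<in> P"
    and P0: "P\<^sub>0 \<in> bipartitions n" "A \<in> P\<^sub>0" and X: "product_state n A X"
  shows "psd (2 ^ n) (Phi_Tx n c X)"
proof -
  have sub: "B \<subseteq> {..<n}" if "P \<in> bipartitions n" "B \<in> P" for P B
    using that by (auto simp: bipartitions_iff)
  obtain Y Z where YZ: "psd (2 ^ card A) Y" "psd (2 ^ card ({..<n} - A)) Z" "X = tensor_op n A Y Z"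
    using X by (auto simp: product_state_def state_def)
  have A: "A \<subseteq> {..<n}" by (rule sub[OF P0])
  have psdX: "psd (2 ^ n) X" unfolding YZ(3) by (rule psd_tensor_op[OF YZ(1,2)])
  have P0_eq: "P\<^sub>0 = {A, {..<n} - A}" using P0 by (auto simp: bipartitions_iff)
  let ?E = "\<lambda>P. tensor_id_map n (c P) (sigma_x_conj (card (c P)) \<circ> transpose_mat) X"
  have "psd (2 ^ n) (?E P\<^sub>0)"
  proof (cases "c P\<^sub>0 = A")
    case True
    then show ?thesis using psd_tensor_id_map_tensor_op[OF A YZ(1,2)] by (simp add: YZ(3))
  next
    \<comment> \<open>The selected part is the complement of \<open>A\<close>, so the state is read
      as a product with its factors exchanged.\<close>
    case False
    then have *: "c P\<^sub>0 = {..<n} - A" using c[OF P0(1)] P0_eq by auto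
    have **: "{..<n} - ({..<n} - A) = A" using A by auto
    show ?thesis
      using psd_tensor_id_map_tensor_op[of "{..<n} - A" n Z Y] YZ A
      by (simp add: * ** tensor_op_commute)
  qed
  then have P0_psd: "psd_on {..<2 ^ n} (\<lambda>i j. ?E P\<^sub>0 $$ (i, j))" by (simp add: psd_iff_psd_on)
  have fin: "finite (bipartitions n)"
    unfolding bipartitions_def
    by (rule finite_subset[of _ "Pow (Pow {..<n})"]) (auto simp: partition_on_def)
  have "card (bipartitions n - {P\<^sub>0}) = 2 ^ (n - 1) - 2"
    using card_bipartitions[of n] n fin P0 by simp
  \<comment> \<open>Ensures that the natural-number subtraction is not truncated when it is cast to
    the complex numbers.\<close>
  moreover have "(2::nat) \<le> 2 ^ (n - 1)"
    using n power_increasing[of 1 "n - 1" "2::nat"] by simp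
  ultimately have card: "(of_nat (card (bipartitions n - {P\<^sub>0})) :: complex) = 2 ^ (n - 1) - 2"
    by (simp add: of_nat_diff)
  have "psd_on {..<2 ^ n} (\<lambda>i j. Phi_Tx n c X $$ (i, j))"
    unfolding psd_on_def
  proof
    fix v :: "nat \<Rightarrow> complex"
    define Q where "Q = (\<lambda>P. \<Sum>i<2 ^ n. \<Sum>j<2 ^ n. cnj (v i) * ?E P $$ (i, j) * v j)"
    define N where "N = (of_real (\<Sum>i<2 ^ n. (cmod (v i))\<^sup>2) :: complex)"
    define \<kappa> :: complex where "\<kappa> = (2 ^ (n - 1) - 2) / 2 * tr X"
    have diag: "(\<Sum>i<2 ^ n. \<Sum>j<2 ^ n. cnj (v i) * (\<kappa> * of_bool (i = j)) * v j) = \<kappa> * N"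
    proof -
      have "(\<Sum>j<2 ^ n. cnj (v i) * (\<kappa> * of_bool (i = j)) * v j) = \<kappa> * of_real ((cmod (v i))\<^sup>2)"
        if "i < 2 ^ n" for i
      proof -
        have "(\<Sum>j<2 ^ n. cnj (v i) * (\<kappa> * of_bool (i = j)) * v j)
            = (\<Sum>j<2 ^ n. if j = i then cnj (v i) * \<kappa> * v i else 0)"
          by (intro sum.cong) auto
        then show ?thesis using that by (simp add: complex_norm_square mult_ac del: of_real_power)
      qed
      then show ?thesis by (simp add: N_def sum_distrib_left del: of_real_power)
    qed
    have "(\<Sum>i<2 ^ n. \<Sum>j<2 ^ n. cnj (v i) * Phi_Tx n c X $$ (i, j) * v j)
        = (\<Sum>i<2 ^ n. \<Sum>j<2 ^ n. cnj (v i) * (\<Sum>P\<in>bipartitions n. ?E P $$ (i, j)) * v j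
            + cnj (v i) * (\<kappa> * of_bool (i = j)) * v j)"
      by (intro sum.cong refl) (simp add: Phi_Tx_index \<kappa>_def ring_distribs)
    also have "\<dots> = (\<Sum>P\<in>bipartitions n. Q P) + \<kappa> * N"
      unfolding sum.distrib form_sum diag Q_def ..
    \<comment> \<open>Exactly \<open>2 ^ (n - 1) - 2\<close> bipartitions differ from
      \<open>P\<^sub>0\<close>, so the identity term splits into one compensating
      \<open>tr X * N / 2\<close> for each of them.\<close>
    also have "\<dots> = Q P\<^sub>0 + (\<Sum>P\<in>bipartitions n - {P\<^sub>0}. Q P + tr X * N / 2)"
      using sum.remove[OF fin P0(1), of Q] by (simp add: sum.distrib card \<kappa>_def)
    also have "0 \<le> \<dots>"
    proof (rule add_nonneg_nonneg[OF _ sum_nonneg])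
      show "0 \<le> Q P\<^sub>0" using P0_psd by (simp add: psd_on_def Q_def)
      fix P assume "P \<in> bipartitions n - {P\<^sub>0}"
      then have "c P \<subseteq> {..<n}" using c sub by blast
      then show "0 \<le> Q P + tr X * N / 2"
        unfolding Q_def N_def by (rule tensor_id_map_form_bound[OF _ psdX])
    qed
    finally show "0 \<le> (\<Sum>i<2 ^ n. \<Sum>j<2 ^ n. cnj (v i) * Phi_Tx n c X $$ (i, j) * v j)" .
  qed
  moreover have "Phi_Tx n c X \<in> carrier_mat (2 ^ n) (2 ^ n)" by (simp add: Phi_Tx_def)
  ultimately show ?thesis by (simp add: psd_iff_psd_on)
qed

text \<open>Each summand of the map only relocates entries of its argument, and the trace is a sum
  of entries, so linear combinations pass through.\<close>

lemma Phi_Tx_sum_index: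
  assumes "i < 2 ^ n" "j < 2 ^ n" "\<And>k. k \<in> K \<Longrightarrow> \<sigma> k \<in> carrier_mat (2 ^ n) (2 ^ n)"
  shows "Phi_Tx n c (mat (2 ^ n) (2 ^ n) (\<lambda>(i, j). \<Sum>k\<in>K. p k * \<sigma> k $$ (i, j))) $$ (i, j)
    = (\<Sum>k\<in>K. p k * Phi_Tx n c (\<sigma> k) $$ (i, j))"
proof -
  let ?\<rho> = "mat (2 ^ n) (2 ^ n) (\<lambda>(i, j). \<Sum>k\<in>K. p k * \<sigma> k $$ (i, j))"
  let ?E = "\<lambda>X P. tensor_id_map n (c P) (sigma_x_conj (card (c P)) \<circ> transpose_mat) X $$ (i, j)"
  define A where "A k = (\<Sum>P\<in>bipartitions n. ?E (\<sigma> k) P)" for k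
  have "?\<rho> $$ (a, b) = (\<Sum>k\<in>K. p k * \<sigma> k $$ (a, b))" if "a < 2 ^ n" "b < 2 ^ n" for a b
    using that by simp
  from this[OF merge_bits_less merge_bits_less]
  have "?E ?\<rho> P = (\<Sum>k\<in>K. p k * ?E (\<sigma> k) P)" for P
    unfolding tensor_id_map_index[OF assms(1,2)] .
  then have "(\<Sum>P\<in>bipartitions n. ?E ?\<rho> P) = (\<Sum>P\<in>bipartitions n. \<Sum>k\<in>K. p k * ?E (\<sigma> k) P)"
    by (intro sum.cong refl)
  also have "\<dots> = (\<Sum>k\<in>K. p k * A k)"
    unfolding A_def sum_distrib_left by (rule sum.swap)
  finally have E: "(\<Sum>P\<in>bipartitions n. ?E ?\<rho> P) = (\<Sum>k\<in>K. p k * A k)" .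
  have "tr ?\<rho> = (\<Sum>i<2 ^ n. \<Sum>k\<in>K. p k * \<sigma> k $$ (i, i))" by (simp add: tr_def)
  also have "\<dots> = (\<Sum>k\<in>K. \<Sum>i<2 ^ n. p k * \<sigma> k $$ (i, i))" by (rule sum.swap)
  also have "\<dots> = (\<Sum>k\<in>K. p k * tr (\<sigma> k))"
    by (intro sum.cong refl) (simp add: tr_def sum_distrib_left carrier_matD(1)[OF assms(3)])
  finally have t: "tr ?\<rho> = (\<Sum>k\<in>K. p k * tr (\<sigma> k))" .
  show ?thesis
    unfolding Phi_Tx_index[OF assms(1,2)] E t A_def[symmetric]
    unfolding sum_distrib_left sum_distrib_right sum.distrib[symmetric]
    by (intro sum.cong refl) (simp add: distrib_left mult_ac)
qed

theorem theorem2: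
  fixes n :: nat and c :: "nat set set \<Rightarrow> nat set" and \<rho> :: "complex mat"
  assumes "n \<ge> 2"
    and "\<And>P. P \<in> bipartitions n \<Longrightarrow> c P \<in> P"
    and "biseparable n \<rho>"
  shows "psd (2 ^ n) (Phi_Tx n c \<rho>)"
proof -
  obtain m :: nat and p :: "nat \<Rightarrow> real" and \<sigma> where
    p: "\<forall>k<m. 0 \<le> p k" and
    \<sigma>: "\<forall>k<m. \<exists>P \<in> bipartitions n. \<exists>A \<in> P. product_state n A (\<sigma> k)" and
    \<rho>: "\<rho> = mat (2 ^ n) (2 ^ n) (\<lambda>(i, j). \<Sum>k<m. complex_of_real (p k) * \<sigma> k $$ (i, j))"
    using assms(3) unfolding biseparable_def by blast
  have psd: "psd (2 ^ n) (Phi_Tx n c (\<sigma> k))" if "k < m" for k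
    using \<sigma> that psd_Phi_Tx_product_state[OF assms(1,2)] by blast
  have carr: "\<sigma> k \<in> carrier_mat (2 ^ n) (2 ^ n)" if "k < m" for k
    using \<sigma> that by (auto simp: product_state_def tensor_op_def)
  \<comment> \<open>Every term is positive by its own bipartition; linearity identifies this
    combination with the image of the mixture.\<close>
  have "psd_on {..<2 ^ n} (\<lambda>i j. \<Sum>k<m. complex_of_real (p k) * Phi_Tx n c (\<sigma> k) $$ (i, j))"
    using p psd by (intro psd_on_conic_combination) (auto simp: psd_iff_psd_on)
  also have "?this \<longleftrightarrow> psd_on {..<2 ^ n} (\<lambda>i j. Phi_Tx n c \<rho> $$ (i, j))"
    unfolding \<rho> using carr by (intro psd_on_cong Phi_Tx_sum_index[symmetric]) auto
  finally show ?thesis by (simp add: psd_iff_psd_on Phi_Tx_def)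
qed

end
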